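(* Let $\xi^t$ be a Markov chain on a locally compact metric space $(X,\varrho)$ with transition probabilities $P^t(x,A)$ and with an invariant probability measure $\mu$, and let $\acute\xi^t$ be another version of the same Markov chain. Assume that there exists a topologically quasi successful coupling of $\xi^t,\acute\xi^t$, i.e. a coupling with laws $\mathbb{P}_{x,y}$ such that $$\mathbb{P}_{x,y}\bigl(1_A(\xi^t)\ne 1_A(\acute\xi^t)\bigr)\longrightarrow 0\quad\text{as } t\to\infty$$ for all $x,y\in X$ and every open set $A\in\mathcal{B}$. Then $\mu$ is the only invariant probability measure of this Markov chain, and $P^t_*\nu\to\mu$ weakly as $t\to\infty$ for any probability measure $\nu$ on $X$.
   Context: $(X,\mathcal{B})$ is a measurable space equipped with a metric $\varrho$ such that $(X,\varrho)$ is a locally compact metric space ($\mathcal B$ is its Borel sigma-algebra). A Markov chain $\xi^t$ (time $t\ge 0$) on $X$ is defined by transition probabilities $P^t(x,A)$, $x\in X$, $A\in\mathcal{B}$, and an initial distribution. It generates the semigroups $P^t\phi(x):=\int\phi(y)\,P^t(x,dy)$ on bounded measurable functions and $P^t_*\mu(\phi):=\mu(P^t\phi)$ on measures, where $\mu(\phi):=\int\phi\,d\mu$. A measure $\mu$ is invariant if $P^t_*\mu=\mu$ for all $t$. $1_A$ is the indicator function of $A$. A coupling is a pairs process $(\xi^t,\acute\xi^t)$ on $X\times X$ whose law $\mathbb{P}_{x,y}$ depends measurably on the initial points $\xi^0=x$, $\acute\xi^0=y$, such that each component is a version of the same Markov chain: $\mathbb{P}_{x,y}((\xi^t,\acute\xi^t)\in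 A\times X)=P^t(x,A)$ and $\mathbb{P}_{x,y}((\xi^t,\acute\xi^t)\in X\times A)=P^t(y,A)$ for all $t\ge0$, $A\in\mathcal{B}$. The coupling is not assumed to be Markovian. *)

theory Defs
  imports "HOL-Probability.Probability"
begin

text \<open>
  The time set \<open>T\<close> is a subset of the nonnegative reals, so that discrete time (\<open>T = \<nat>\<close>) and
  continuous time (\<open>T = {0..}\<close>) are treated uniformly. Membership of \<open>P t\<close> in
  \<open>borel \<rightarrow>\<^sub>M prob_algebra borel\<close> says that every \<open>P t x\<close> is a Borel probability measure and
  that \<open>x \<mapsto> P t x A\<close> is measurable for every Borel set \<open>A\<close>. The last clause is the
  Chapman-Kolmogorov equation.
\<close>

definition markov_transition ::
  "real set \<Rightarrow> (real \<Rightarrow> 'a::topological_space \<Rightarrow> 'a measure) \<Rightarrow> bool" where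
  "markov_transition T P \<longleftrightarrow>
     (\<forall>t\<in>T. P t \<in> borel \<rightarrow>\<^sub>M prob_algebra borel) \<and>
     (\<forall>x. P 0 x = return borel x) \<and>
     (\<forall>s\<in>T. \<forall>t\<in>T. \<forall>x. P (s + t) x = P s x \<bind> P t)"

definition semigroup_fun ::
  "(real \<Rightarrow> 'a \<Rightarrow> 'a measure) \<Rightarrow> real \<Rightarrow> ('a \<Rightarrow> real) \<Rightarrow> 'a \<Rightarrow> real" where
  "semigroup_fun P t \<phi> x = (\<integral>y. \<phi> y \<partial>P t x)"

text \<open>
  The dual action on measures is the Giry monad bind; the duality with the action on bounded
  measurable functions is the lemma below.
\<close>

definition semigroup_meas ::
  "(real \<Rightarrow> 'a \<Rightarrow> 'a measure) \<Rightarrow> real \<Rightarrow> 'a measure \<Rightarrow> 'a measure" where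
  "semigroup_meas P t \<nu> = \<nu> \<bind> P t"

lemma semigroup_duality:
  fixes P :: "real \<Rightarrow> 'a::topological_space \<Rightarrow> 'a measure"
  assumes P: "P t \<in> borel \<rightarrow>\<^sub>M prob_algebra borel"
    and \<nu>: "\<nu> \<in> space (prob_algebra borel)"
    and \<phi>: "\<phi> \<in> borel_measurable borel" "bounded (range \<phi>)"
  shows "(\<integral>x. \<phi> x \<partial>semigroup_meas P t \<nu>) = (\<integral>x. semigroup_fun P t \<phi> x \<partial>\<nu>)"
proof -
  have sets: "sets \<nu> = sets borel" and prob: "prob_space \<nu>"
    using \<nu> by (auto simp: space_prob_algebra)
  obtain B where B: "\<And>x. \<bar>\<phi> x\<bar> \<le> B"
    using \<phi>(2) by (auto simp: bounded_iff)
  have K: "P t \<in> measurable \<nu> (subprob_algebra borel)"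
    using measurable_prob_algebraD[OF P] by (simp add: measurable_cong_sets[OF sets refl])
  interpret prob_space \<nu> by (fact prob)
  have mass: "emeasure (P t x) (space (P t x)) \<le> ennreal 1" for x
  proof -
    have "P t x \<in> space (prob_algebra borel)"
      using measurable_space[OF P] by simp
    then show ?thesis
      by (simp add: space_prob_algebra prob_space.emeasure_space_1)
  qed
  show ?thesis
    unfolding semigroup_meas_def semigroup_fun_def
    by (rule integral_bind[where K = borel and B = B and B' = 1])
       (use K \<phi>(1) B mass finite_measure_axioms in \<open>auto\<close>)
qed

definition invariant_prob ::
  "real set \<Rightarrow> (real \<Rightarrow> 'a::topological_space \<Rightarrow> 'a measure) \<Rightarrow> 'a measure \<Rightarrow> bool" where
  "invariant_prob T P \<mu> \<longleftrightarrow>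
     \<mu> \<in> space (prob_algebra borel) \<and> (\<forall>t\<in>T. semigroup_meas P t \<mu> = \<mu>)"

text \<open>
  A pairs process is given through its laws \<open>Q x y\<close> on path space: under \<open>Q x y\<close> the coordinates
  \<open>fst (\<omega> t)\<close> and \<open>snd (\<omega> t)\<close> are the two components at time \<open>t\<close>. Since \<open>P 0 x\<close> is the point
  mass at \<open>x\<close>, the marginal conditions at time \<open>0\<close> say that the components start in \<open>x\<close> and \<open>y\<close>
  almost surely. No Markov property of the pair is required.
\<close>

abbreviation pair_paths :: "real set \<Rightarrow> (real \<Rightarrow> 'a::topological_space \<times> 'a) measure" where
  "pair_paths T \<equiv> Pi\<^sub>M T (\<lambda>_. borel \<Otimes>\<^sub>M borel)"

definition coupling ::
  "real set \<Rightarrow> (real \<Rightarrow> 'a::topological_space \<Rightarrow> 'a measure) \<Rightarrow>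
   ('a \<Rightarrow> 'a \<Rightarrow> (real \<Rightarrow> 'a \<times> 'a) measure) \<Rightarrow> bool" where
  "coupling T P Q \<longleftrightarrow>
     (\<lambda>(x, y). Q x y) \<in> borel \<Otimes>\<^sub>M borel \<rightarrow>\<^sub>M prob_algebra (pair_paths T) \<and>
     (\<forall>x y. \<forall>t\<in>T. \<forall>A\<in>sets borel.
        measure (Q x y) {\<omega> \<in> space (Q x y). \<omega> t \<in> A \<times> UNIV} = measure (P t x) A \<and>
        measure (Q x y) {\<omega> \<in> space (Q x y). \<omega> t \<in> UNIV \<times> A} = measure (P t y) A)"

text \<open>The filter \<open>t \<rightarrow> \<infinity>\<close> with \<open>t\<close> restricted to the time set.\<close>

abbreviation time_at_top :: "real set \<Rightarrow> real filter" where
  "time_at_top T \<equiv> inf at_top (principal T)"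

definition top_quasi_successful ::
  "real set \<Rightarrow> ('a::topological_space \<Rightarrow> 'a \<Rightarrow> (real \<Rightarrow> 'a \<times> 'a) measure) \<Rightarrow> bool" where
  "top_quasi_successful T Q \<longleftrightarrow>
     (\<forall>x y A. open A \<longrightarrow>
        ((\<lambda>t. measure (Q x y) {\<omega> \<in> space (Q x y).
                 (indicator A (fst (\<omega> t)) :: real) \<noteq> indicator A (snd (\<omega> t))})
          \<longlongrightarrow> 0) (time_at_top T))"

text \<open>
  Weak convergence against bounded continuous functions; the library's \<open>weak_conv_m\<close> covers only
  sequences of measures on the real line.
\<close>

definition weak_limit ::
  "('t \<Rightarrow> 'a::topological_space measure) \<Rightarrow> 'a measure \<Rightarrow> 't filter \<Rightarrow> bool" where
  "weak_limit N \<mu> F \<longleftrightarrow>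
     (\<forall>\<phi>::'a \<Rightarrow> real. continuous_on UNIV \<phi> \<longrightarrow> bounded (range \<phi>) \<longrightarrow>
        ((\<lambda>t. \<integral>x. \<phi> x \<partial>N t) \<longlongrightarrow> (\<integral>x. \<phi> x \<partial>\<mu>)) F)"

end

theory Submission
  imports Defs
begin

text \<open>
  Fix an open set \<open>A\<close>. The two coordinates of a coupling have laws \<open>P t x\<close> and \<open>P t y\<close>, so
  \<open>P t x A\<close> and \<open>P t y A\<close> differ by at most the probability that exactly one coordinate lies in
  \<open>A\<close>; topological quasi success makes this difference vanish as time grows
  (\<open>transition_prob_diff_tendsto_0\<close>). Integrating over \<open>y\<close> with respect to the invariant measure
  \<open>\<mu>\<close> gives \<open>P t x A \<longlongrightarrow> \<mu> A\<close> for every \<open>x\<close>, because invariance turns the average of \<open>P t y A\<close>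
  into \<open>\<mu> A\<close>. Integrating next over \<open>x\<close> with respect to an arbitrary initial law \<open>\<nu>\<close> shows
  that the law at time \<open>t\<close> gives \<open>A\<close> a mass that tends to \<open>\<mu> A\<close>
  (\<open>semigroup_meas_open_tendsto\<close>). Both integrations are instances of dominated convergence.

  The two conclusions follow from this convergence on open sets. If \<open>\<nu>\<close> is invariant, the mass of
  \<open>A\<close> is constant in time, so \<open>\<nu>\<close> and \<open>\<mu>\<close> agree on open sets and hence on the Borel sets they
  generate. For weak convergence, a continuous function with values in \<open>[0, 1]\<close> is a uniform limit
  of averages of indicators of its open superlevel sets (\<open>weak_limit_of_open_sets\<close>).
\<close>

section \<open>Dominated convergence along a time set\<close>

text \<open>
  Setting a function to its limit at times outside \<open>T\<close> reduces convergence within \<open>T\<close> to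
  convergence along all of \<open>at_top\<close>. Discrete and continuous time are thereby covered at once by
  dominated convergence with a real parameter.
\<close>

lemma tendsto_time_at_top_iff:
  "(f \<longlongrightarrow> l) (time_at_top T) \<longleftrightarrow> ((\<lambda>t. if t \<in> T then f t else l) \<longlongrightarrow> l) at_top"
proof -
  have "(\<forall>\<^sub>F t in time_at_top T. f t \<in> S) \<longleftrightarrow>
        (\<forall>\<^sub>F t in at_top. (if t \<in> T then f t else l) \<in> S)" if "l \<in> S" for S
    unfolding eventually_inf_principal
    by (rule eventually_cong[OF always_eventually]) (use that in auto)
  then show ?thesis
    unfolding tendsto_def by blast
qed

lemma bounded_convergence_time_at_top:
  fixes f :: "real \<Rightarrow> 'b \<Rightarrow> real"
  assumes "finite_measure M"
    and f: "\<And>t. t \<in> T \<Longrightarrow> f t \<in> borel_measurable M"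
    and g: "g \<in> borel_measurable M"
    and bound: "\<And>t x. t \<in> T \<Longrightarrow> \<bar>f t x\<bar> \<le> B" "\<And>x. \<bar>g x\<bar> \<le> B"
    and lim: "\<And>x. ((\<lambda>t. f t x) \<longlongrightarrow> g x) (time_at_top T)"
  shows "((\<lambda>t. \<integral>x. f t x \<partial>M) \<longlongrightarrow> (\<integral>x. g x \<partial>M)) (time_at_top T)"
proof -
  interpret finite_measure M by fact
  have "((\<lambda>t. \<integral>x. (if t \<in> T then f t x else g x) \<partial>M) \<longlongrightarrow> (\<integral>x. g x \<partial>M)) at_top"
  proof (rule integral_dominated_convergence_at_top[where w = "\<lambda>_. B"])
    show "AE x in M. ((\<lambda>t. if t \<in> T then f t x else g x) \<longlongrightarrow> g x) at_top"
      using lim by (simp add: tendsto_time_at_top_iff)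
    show "\<forall>\<^sub>F t in at_top. AE x in M. norm (if t \<in> T then f t x else g x) \<le> B"
      using bound by simp
    show "(\<lambda>x. if t \<in> T then f t x else g x) \<in> borel_measurable M" for t
      using f g by (cases "t \<in> T") simp_all
  qed (use g in auto)
  moreover have "(\<lambda>t. \<integral>x. (if t \<in> T then f t x else g x) \<partial>M) =
      (\<lambda>t. if t \<in> T then \<integral>x. f t x \<partial>M else \<integral>x. g x \<partial>M)"
    by auto
  ultimately show ?thesis
    by (simp add: tendsto_time_at_top_iff)
qed

lemma time_at_top_neq_bot:
  assumes "T = \<nat> \<or> T = {0..}"
  shows "time_at_top T \<noteq> bot"
proof
  assume "time_at_top T = bot"
  then have "\<forall>\<^sub>F t in at_top. t \<notin> T"
    by (simp add: trivial_limit_def eventually_inf_principal)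
  then obtain b where b: "\<And>t. b \<le> t \<Longrightarrow> t \<notin> T"
    by (auto simp: eventually_at_top_linorder)
  have "real (nat \<lceil>b\<rceil>) \<in> T"
    using assms by auto
  moreover have "b \<le> real (nat \<lceil>b\<rceil>)"
    by linarith
  ultimately show False
    using b by blast
qed

section \<open>Laws of the chain\<close>

lemma semigroup_meas_prob_algebra:
  assumes P: "P t \<in> borel \<rightarrow>\<^sub>M prob_algebra borel"
    and \<nu>: "\<nu> \<in> space (prob_algebra borel)"
  shows "semigroup_meas P t \<nu> \<in> space (prob_algebra borel)"
proof -
  have "(\<lambda>_. \<nu> \<bind> P t) \<in> \<nu> \<rightarrow>\<^sub>M prob_algebra borel"
    by (rule measurable_bind_prob_space[where N = borel, OF measurable_const[OF \<nu>] P])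
  moreover obtain x where "x \<in> space \<nu>"
    using \<nu> prob_space.not_empty by (auto simp: space_prob_algebra)
  ultimately show ?thesis
    unfolding semigroup_meas_def by (rule measurable_space)
qed

lemma measure_transition_measurable:
  assumes "P t \<in> borel \<rightarrow>\<^sub>M prob_algebra borel" "A \<in> sets borel"
  shows "(\<lambda>x. measure (P t x) A) \<in> borel_measurable borel"
  by (rule measurable_compose[OF measurable_prob_algebraD[OF assms(1)]
        measurable_measure_subprob_algebra[OF assms(2)]])

lemma measure_semigroup_meas:
  fixes P :: "real \<Rightarrow> 'a::topological_space \<Rightarrow> 'a measure"
  assumes P: "P t \<in> borel \<rightarrow>\<^sub>M prob_algebra borel"
    and \<nu>: "\<nu> \<in> space (prob_algebra borel)"
    and A: "A \<in> sets borel"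
  shows "measure (semigroup_meas P t \<nu>) A = (\<integral>x. measure (P t x) A \<partial>\<nu>)"
proof -
  have integral_ind: "(\<integral>x. indicator A x \<partial>M) = measure M A"
    if "M \<in> space (prob_algebra borel)" for M :: "'a measure"
  proof -
    have "space M = UNIV"
      using that by (auto simp: space_prob_algebra dest: sets_eq_imp_space_eq)
    then show ?thesis
      by simp
  qed
  have "P t x \<in> space (prob_algebra borel)" for x
    using measurable_space[OF P] by simp
  then have "semigroup_fun P t (indicator A) = (\<lambda>x. measure (P t x) A)"
    unfolding semigroup_fun_def by (intro ext integral_ind)
  moreover have "bounded (range (indicator A :: 'a \<Rightarrow> real))"
    by (auto simp: bounded_iff indicator_def intro!: exI[of _ 1])
  moreover have "(indicator A :: 'a \<Rightarrow> real) \<in> borel_measurable borel"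
    using A by (rule borel_measurable_indicator)
  ultimately show ?thesis
    using semigroup_duality[where P = P and t = t, OF P \<nu>, of "indicator A"]
    unfolding integral_ind[OF semigroup_meas_prob_algebra[of P t \<nu>, OF P \<nu>]]
    by (simp only:)
qed

section \<open>From the coupling to convergence on open sets\<close>

text \<open>
  The coupling inequality: both transition probabilities are probabilities of events under the one
  law \<open>Q x y\<close>, and these events differ only where exactly one coordinate lies in \<open>A\<close>.
\<close>

lemma transition_prob_diff_le:
  assumes coupling: "coupling T P Q" and t: "t \<in> T" and A: "A \<in> sets borel"
  shows "\<bar>measure (P t y) A - measure (P t x) A\<bar> \<le>
    measure (Q x y) {\<omega> \<in> space (Q x y).
      (indicator A (fst (\<omega> t)) :: real) \<noteq> indicator A (snd (\<omega> t))}"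
    (is "_ \<le> measure _ ?D")
proof -
  have "(\<lambda>(x, y). Q x y) \<in> borel \<Otimes>\<^sub>M borel \<rightarrow>\<^sub>M prob_algebra (pair_paths T)"
    using coupling by (simp only: coupling_def)
  from measurable_space[OF this, of "(x, y)"]
  have "Q x y \<in> space (prob_algebra (pair_paths T))"
    by (simp add: space_pair_measure)
  then have sets: "sets (Q x y) = sets (pair_paths T)" and prob: "prob_space (Q x y)"
    by (simp_all only: space_prob_algebra mem_Collect_eq)
  interpret prob_space "Q x y" by (fact prob)
  let ?E = "{\<omega> \<in> space (Q x y). \<omega> t \<in> A \<times> UNIV}"
  let ?F = "{\<omega> \<in> space (Q x y). \<omega> t \<in> UNIV \<times> A}"
  have comp: "(\<lambda>\<omega>. \<omega> t) \<in> Q x y \<rightarrow>\<^sub>M borel \<Otimes>\<^sub>M borel"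
    unfolding measurable_cong_sets[OF sets refl] using t by (rule measurable_component_singleton)
  have event: "{\<omega> \<in> space (Q x y). \<omega> t \<in> S} \<in> events" if "S \<in> sets (borel \<Otimes>\<^sub>M borel)" for S
    using measurable_sets[OF comp that] by (simp add: vimage_def Int_def conj_commute)
  have E: "?E \<in> events" and F: "?F \<in> events"
    using A by (intro event pair_measureI; simp)+
  have D: "?D = (?E - ?F) \<union> (?F - ?E)"
    by (auto simp: indicator_def mem_Times_iff split: if_splits)
  have D_events: "?D \<in> events"
    unfolding D using E F by (intro sets.Un sets.Diff)
  have "prob ?E \<le> prob (?F \<union> ?D)" "prob ?F \<le> prob (?E \<union> ?D)"
    using E F D_events unfolding D by (intro finite_measure_mono sets.Un; blast)+
  then have "prob ?E \<le> prob ?F + prob ?D" "prob ?F \<le> prob ?E + prob ?D"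
    using measure_Un_le[OF F D_events] measure_Un_le[OF E D_events]
    by linarith+
  moreover have "prob ?E = measure (P t x) A" "prob ?F = measure (P t y) A"
    using coupling t A unfolding coupling_def by blast+
  ultimately show ?thesis
    by linarith
qed

lemma transition_prob_diff_tendsto_0:
  assumes coupling: "coupling T P Q" and success: "top_quasi_successful T Q" and A: "open A"
  shows "((\<lambda>t. measure (P t y) A - measure (P t x) A) \<longlongrightarrow> 0) (time_at_top T)"
proof (rule Lim_null_comparison)
  show "\<forall>\<^sub>F t in time_at_top T. norm (measure (P t y) A - measure (P t x) A) \<le>
      measure (Q x y) {\<omega> \<in> space (Q x y).
        (indicator A (fst (\<omega> t)) :: real) \<noteq> indicator A (snd (\<omega> t))}"
    using transition_prob_diff_le[OF coupling] A by (simp add: eventually_inf_principal)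
qed (use success A in \<open>auto simp: top_quasi_successful_def\<close>)

text \<open>
  The coupling only compares two starting points. Averaging the second one over \<open>\<mu>\<close> replaces its
  transition probability by a limit independent of time, and averaging the first over \<open>\<nu>\<close> then
  passes from point masses to general initial laws.
\<close>

lemma semigroup_meas_open_tendsto:
  fixes P :: "real \<Rightarrow> 'a::topological_space \<Rightarrow> 'a measure"
  assumes markov: "markov_transition T P"
    and invariant: "invariant_prob T P \<mu>"
    and coupling: "coupling T P Q" "top_quasi_successful T Q"
    and \<nu>: "\<nu> \<in> space (prob_algebra borel)"
    and A: "open A"
  shows "((\<lambda>t. measure (semigroup_meas P t \<nu>) A) \<longlongrightarrow> measure \<mu> A) (time_at_top T)"
proof -
  have P: "P t \<in> borel \<rightarrow>\<^sub>M prob_algebra borel" if "t \<in> T" for t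
    using markov that by (auto simp: markov_transition_def)
  have \<mu>: "\<mu> \<in> space (prob_algebra borel)"
    and fixed: "\<And>t. t \<in> T \<Longrightarrow> semigroup_meas P t \<mu> = \<mu>"
    using invariant by (simp_all add: invariant_prob_def)
  have probD: "prob_space M" if "M \<in> space (prob_algebra borel)" for M :: "'a measure"
    using that by (simp add: space_prob_algebra)
  have bound: "measure (P t x) A \<le> 1" if "t \<in> T" for t x
    using measurable_space[OF P[OF that], of x] by (intro prob_space.prob_le_1 probD) simp
  have meas: "(\<lambda>x. measure (P t x) A) \<in> borel_measurable M"
    if "t \<in> T" "M \<in> space (prob_algebra borel)" for t and M :: "'a measure"
  proof -
    have "sets M = sets borel"
      using that(2) by (simp add: space_prob_algebra)
    then show ?thesis
      using measure_transition_measurable[of P t A, OF P[OF that(1)] borel_open[OF A]]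
      by (simp only: measurable_cong_sets[OF \<open>sets M = sets borel\<close> refl])
  qed
  have average: "measure (semigroup_meas P t M) A = (\<integral>x. measure (P t x) A \<partial>M)"
    if "t \<in> T" "M \<in> space (prob_algebra borel)" for t and M :: "'a measure"
    using measure_semigroup_meas[of P t M A, OF P[OF that(1)] that(2) borel_open[OF A]] .
  have in_T: "\<forall>\<^sub>F t in time_at_top T. t \<in> T"
    by (simp add: eventually_inf_principal)
  have pointwise: "((\<lambda>t. measure (P t x) A) \<longlongrightarrow> measure \<mu> A) (time_at_top T)" for x
  proof -
    interpret \<mu>: prob_space \<mu> by (rule probD[OF \<mu>])
    have "((\<lambda>t. \<integral>y. measure (P t y) A - measure (P t x) A \<partial>\<mu>) \<longlongrightarrow> (\<integral>y. 0 \<partial>\<mu>))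
        (time_at_top T)"
    proof (rule bounded_convergence_time_at_top[where B = 1])
      show "\<bar>measure (P t y) A - measure (P t x) A\<bar> \<le> 1" if "t \<in> T" for t y
        using bound[OF that, of x] bound[OF that, of y]
          measure_nonneg[of "P t x" A] measure_nonneg[of "P t y" A] by linarith
      show "(\<lambda>y. measure (P t y) A - measure (P t x) A) \<in> borel_measurable \<mu>"
        if "t \<in> T" for t
        using meas[OF that \<mu>] by simp
      show "((\<lambda>t. measure (P t y) A - measure (P t x) A) \<longlongrightarrow> 0) (time_at_top T)" for y
        by (rule transition_prob_diff_tendsto_0[OF coupling A])
    qed (simp_all add: \<mu>.finite_measure_axioms)
    then have "((\<lambda>t. \<integral>y. measure (P t y) A - measure (P t x) A \<partial>\<mu>) \<longlongrightarrow> 0) (time_at_top T)"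
      by simp
    \<comment> \<open>By invariance the first term of the integrand averages to \<open>\<mu> A\<close>.\<close>
    moreover have "(\<integral>y. measure (P t y) A - measure (P t x) A \<partial>\<mu>) =
        measure \<mu> A - measure (P t x) A" if "t \<in> T" for t
    proof -
      have "integrable \<mu> (\<lambda>y. measure (P t y) A)"
        using meas[OF that \<mu>] bound[OF that] by (intro \<mu>.integrable_const_bound[of _ 1]) simp_all
      then show ?thesis
        using average[OF that \<mu>] fixed[OF that] by (simp add: \<mu>.prob_space)
    qed
    ultimately have "((\<lambda>t. measure \<mu> A - measure (P t x) A) \<longlongrightarrow> 0) (time_at_top T)"
      by (rule Lim_transform_eventually[OF _ eventually_mono[OF in_T]])
    from tendsto_diff[OF tendsto_const[of "measure \<mu> A"] this] show ?thesis
      by simp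
  qed
  interpret \<nu>: prob_space \<nu> by (rule probD[OF \<nu>])
  have "((\<lambda>t. \<integral>x. measure (P t x) A \<partial>\<nu>) \<longlongrightarrow> (\<integral>x. measure \<mu> A \<partial>\<nu>)) (time_at_top T)"
  proof (rule bounded_convergence_time_at_top[where B = 1])
    show "\<bar>measure (P t x) A\<bar> \<le> 1" if "t \<in> T" for t x
      using bound[OF that] by simp
    show "\<bar>measure \<mu> A\<bar> \<le> 1"
      using prob_space.prob_le_1[OF probD[OF \<mu>]] by simp
  qed (rule meas \<nu> pointwise \<nu>.finite_measure_axioms borel_measurable_const | assumption)+
  then have "((\<lambda>t. \<integral>x. measure (P t x) A \<partial>\<nu>) \<longlongrightarrow> measure \<mu> A) (time_at_top T)"
    by (simp add: \<nu>.prob_space)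
  moreover have "\<forall>\<^sub>F t in time_at_top T.
      (\<integral>x. measure (P t x) A \<partial>\<nu>) = measure (semigroup_meas P t \<nu>) A"
    using in_T by eventually_elim (simp add: average[OF _ \<nu>])
  ultimately show ?thesis
    by (rule Lim_transform_eventually)
qed

section \<open>Consequences of convergence on open sets\<close>

lemma prob_measures_eqI_open:
  fixes M N :: "'a::topological_space measure"
  assumes M: "M \<in> space (prob_algebra borel)" and N: "N \<in> space (prob_algebra borel)"
    and eq: "\<And>A. open A \<Longrightarrow> measure M A = measure N A"
  shows "M = N"
proof (rule measure_eqI_generator_eq[where E = "{A. open A}" and \<Omega> = UNIV and A = "\<lambda>_. UNIV"])
  interpret M: prob_space M using M by (simp add: space_prob_algebra)
  interpret N: prob_space N using N by (simp add: space_prob_algebra)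
  show "Int_stable {A :: 'a set. open A}"
    by (auto simp: Int_stable_def)
  show "sets M = sigma_sets UNIV {A. open A}" "sets N = sigma_sets UNIV {A. open A}"
    using M N by (simp_all add: space_prob_algebra sets_borel)
  show "emeasure M A = emeasure N A" if "A \<in> {A. open A}" for A
    using eq that by (simp add: M.emeasure_eq_measure N.emeasure_eq_measure)
  show "emeasure M UNIV \<noteq> \<infinity>" for i :: nat
    by simp
qed auto

text \<open>
  Counting the levels \<open>k / n\<close> below \<open>u\<close> amounts to rounding \<open>n * u\<close> up to an integer.
\<close>

lemma level_count_approx:
  fixes u :: real
  assumes "0 \<le> u" "u \<le> 1" "0 < n"
  shows "\<bar>(\<Sum>k<n. indicator {real k / real n<..} u) / real n - u\<bar> \<le> 1 / real n"
proof -
  have "{k. k < n \<and> real k / real n < u} = {..<nat \<lceil>real n * u\<rceil>}"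
  proof (intro set_eqI)
    fix k
    have "real n * u \<le> real n"
      using assms by (simp add: mult_left_le)
    then have "k < n" if "real k < real n * u"
      using that by linarith
    moreover have "real k / real n < u \<longleftrightarrow> real k < real n * u"
      using assms by (simp add: field_simps)
    moreover have "real k < real n * u \<longleftrightarrow> k < nat \<lceil>real n * u\<rceil>"
      by linarith
    ultimately show "k \<in> {k. k < n \<and> real k / real n < u} \<longleftrightarrow> k \<in> {..<nat \<lceil>real n * u\<rceil>}"
      by auto
  qed
  moreover have "(\<Sum>k<n. indicator {real k / real n<..} u) =
      real (card {k. k < n \<and> real k / real n < u})"
    by (simp add: indicator_def sum.If_cases Int_def lessThan_def conj_commute)
  ultimately have "(\<Sum>k<n. indicator {real k / real n<..} u) = real (nat \<lceil>real n * u\<rceil>)"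
    by simp
  moreover have "\<bar>real (nat \<lceil>real n * u\<rceil>) - real n * u\<bar> \<le> 1"
    using mult_nonneg_nonneg[of "real n" u] assms by linarith
  moreover have "c / real n - u = (c - real n * u) / real n" for c
    using assms by (simp add: field_simps)
  ultimately show ?thesis
    by (simp add: abs_divide divide_right_mono)
qed

text \<open>
  Integrating the level count bounds the integral of a \<open>[0, 1]\<close>-valued function by finitely many
  measures of superlevel sets, with an error that is the same for every probability measure.
\<close>

lemma integral_superlevel_approx:
  fixes \<psi> :: "'a \<Rightarrow> real"
  assumes "prob_space M"
    and \<psi>: "\<psi> \<in> borel_measurable M"
    and range: "\<And>x. 0 \<le> \<psi> x" "\<And>x. \<psi> x \<le> 1"
    and n: "0 < n"
  shows "\<bar>(\<Sum>k<n. measure M {x \<in> space M. real k / real n < \<psi> x}) / real n - (\<integral>x. \<psi> x \<partial>M)\<bar>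
    \<le> 1 / real n"
proof -
  interpret prob_space M by fact
  let ?s = "\<lambda>x. (\<Sum>k<n. indicator {real k / real n<..} (\<psi> x)) / real n :: real"
  have ind: "integrable M (\<lambda>x. indicator {real k / real n<..} (\<psi> x) :: real)" for k
    by (rule integrable_const_bound[of _ 1]) (use \<psi> in auto)
  then have int_s: "integrable M ?s"
    by auto
  have int_\<psi>: "integrable M \<psi>"
    by (rule integrable_const_bound[of _ 1]) (use \<psi> range in auto)
  have "(\<integral>x. indicator {real k / real n<..} (\<psi> x) \<partial>M) =
      prob {x \<in> space M. real k / real n < \<psi> x}" for k
  proof -
    have "(\<integral>x. indicator {real k / real n<..} (\<psi> x) \<partial>M) =
        (\<integral>x. indicator {x \<in> space M. real k / real n < \<psi> x} x \<partial>M :: real)"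
      by (rule Bochner_Integration.integral_cong) (auto simp: indicator_def)
    also have "\<dots> = prob {x \<in> space M. real k / real n < \<psi> x}"
      by (simp add: Int_def conj_commute)
    finally show ?thesis .
  qed
  then have "(\<Sum>k<n. prob {x \<in> space M. real k / real n < \<psi> x}) / real n - (\<integral>x. \<psi> x \<partial>M) =
      (\<integral>x. ?s x - \<psi> x \<partial>M)"
    using ind int_s int_\<psi> by simp
  also have "\<bar>\<dots>\<bar> \<le> (\<integral>x. \<bar>?s x - \<psi> x\<bar> \<partial>M)"
    by (rule integral_abs_bound)
  also have "\<dots> \<le> (\<integral>x. 1 / real n \<partial>M)"
    by (rule integral_mono)
      (use int_s int_\<psi> level_count_approx[OF range n] in auto)
  finally show ?thesis
    by (simp add: prob_space)
qed

lemma weak_limit_of_open_sets: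
  fixes \<mu> :: "'a::topological_space measure"
  assumes N: "\<forall>\<^sub>F t in F. N t \<in> space (prob_algebra borel)"
    and \<mu>: "\<mu> \<in> space (prob_algebra borel)"
    and lim: "\<And>A. open A \<Longrightarrow> ((\<lambda>t. measure (N t) A) \<longlongrightarrow> measure \<mu> A) F"
  shows "weak_limit N \<mu> F"
proof -
  have probD: "prob_space M" "sets M = sets borel" "space M = UNIV"
    if "M \<in> space (prob_algebra borel)" for M :: "'a measure"
    using that by (auto simp: space_prob_algebra dest: sets_eq_imp_space_eq)
  have unit: "((\<lambda>t. \<integral>x. \<psi> x \<partial>N t) \<longlongrightarrow> (\<integral>x. \<psi> x \<partial>\<mu>)) F"
    if cont: "continuous_on UNIV \<psi>" and range: "\<And>x. 0 \<le> \<psi> x" "\<And>x. \<psi> x \<le> 1"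
    for \<psi> :: "'a \<Rightarrow> real"
  proof (rule tendstoI)
    fix e :: real assume e: "0 < e"
    \<comment> \<open>One third of the error is spent on the level counts for \<open>N t\<close>, one on those for \<open>\<mu>\<close>, and one
      on the distance between the two.\<close>
    obtain n where n: "0 < n" "1 / real n < e / 3"
      using reals_Archimedean[of "e / 3"] e 
      by (metis inverse_eq_divide zero_less_Suc divide_pos_pos zero_less_numeral)
    let ?S = "\<lambda>M. (\<Sum>k<n. measure M {x. real k / real n < \<psi> x}) / real n"
    have approx: "\<bar>?S M - (\<integral>x. \<psi> x \<partial>M)\<bar> \<le> 1 / real n" if "M \<in> space (prob_algebra borel)"
      for M :: "'a measure"
    proof -
      have "\<psi> \<in> borel_measurable M"
        using borel_measurable_continuous_onI[OF cont]
        by (simp only: measurable_cong_sets[OF probD(2)[OF that] refl])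
      from integral_superlevel_approx[OF probD(1)[OF that] this range n(1)] show ?thesis
        by (simp add: probD(3)[OF that])
    qed
    have "open {x. real k / real n < \<psi> x}" for k
      using cont by (intro open_Collect_less continuous_intros)
    then have "((\<lambda>t. ?S (N t)) \<longlongrightarrow> ?S \<mu>) F"
      using n(1) by (intro tendsto_intros lim) auto
    then have "\<forall>\<^sub>F t in F. dist (?S (N t)) (?S \<mu>) < e / 3"
      using e by (intro tendstoD) auto
    with N show "\<forall>\<^sub>F t in F. dist (\<integral>x. \<psi> x \<partial>N t) (\<integral>x. \<psi> x \<partial>\<mu>) < e"
    proof eventually_elim
      case (elim t)
      then show ?case
        using approx[OF elim(1)] approx[OF \<mu>] n(2) unfolding dist_real_def by linarith
    qed
  qed
  show ?thesis
    unfolding weak_limit_def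
  proof (intro allI impI)
    fix \<phi> :: "'a \<Rightarrow> real"
    assume cont: "continuous_on UNIV \<phi>" and "bounded (range \<phi>)"
    then obtain B where B: "0 < B" "\<And>x. \<bar>\<phi> x\<bar> \<le> B"
      by (auto simp: bounded_pos)
    define \<psi> where "\<psi> x = (\<phi> x + B) / (2 * B)" for x
    have "((\<lambda>t. \<integral>x. \<psi> x \<partial>N t) \<longlongrightarrow> (\<integral>x. \<psi> x \<partial>\<mu>)) F"
    proof (rule unit)
      show "continuous_on UNIV \<psi>"
        unfolding \<psi>_def using cont B(1) by (intro continuous_intros) auto
      show "0 \<le> \<psi> x" "\<psi> x \<le> 1" for x
        using B(1) B(2)[of x] by (auto simp: \<psi>_def abs_le_iff field_simps)
    qed
    then have lim_\<psi>: "((\<lambda>t. 2 * B * (\<integral>x. \<psi> x \<partial>N t) - B) \<longlongrightarrow> 2 * B * (\<integral>x. \<psi> x \<partial>\<mu>) - B) F"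
      by (intro tendsto_intros)
    have rescale: "2 * B * (\<integral>x. \<psi> x \<partial>M) - B = (\<integral>x. \<phi> x \<partial>M)"
      if "M \<in> space (prob_algebra borel)" for M :: "'a measure"
    proof -
      interpret prob_space M using probD(1)[OF that] .
      have "\<phi> \<in> borel_measurable M"
        using borel_measurable_continuous_onI[OF cont]
        by (simp only: measurable_cong_sets[OF probD(2)[OF that] refl])
      then have "integrable M \<phi>"
        by (intro integrable_const_bound[of _ B]) (use B in auto)
      then show ?thesis
        using B(1) by (simp add: \<psi>_def prob_space)
    qed
    show "((\<lambda>t. \<integral>x. \<phi> x \<partial>N t) \<longlongrightarrow> (\<integral>x. \<phi> x \<partial>\<mu>)) F"
      using lim_\<psi> eventually_mono[OF N rescale] unfolding rescale[OF \<mu>]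
      by (rule Lim_transform_eventually)
  qed
qed

section \<open>Uniqueness and stability of the invariant measure\<close>

theorem theorem3p1:
  fixes T :: "real set"
    and P :: "real \<Rightarrow> 'a::metric_space \<Rightarrow> 'a measure"
    and \<mu> :: "'a measure"
  assumes time: "T = \<nat> \<or> T = {0..}"
    and loc_compact: "locally compact (UNIV :: 'a set)"
    and markov: "markov_transition T P"
    and invariant: "invariant_prob T P \<mu>"
    and coupling: "\<exists>Q. coupling T P Q \<and> top_quasi_successful T Q"
  shows "(\<forall>\<nu>. invariant_prob T P \<nu> \<longrightarrow> \<nu> = \<mu>) \<and>
         (\<forall>\<nu>\<in>space (prob_algebra (borel :: 'a measure)).
            weak_limit (\<lambda>t. semigroup_meas P t \<nu>) \<mu> (time_at_top T))"
proof (intro conjI allI impI ballI)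
  obtain Q where Q: "coupling T P Q" "top_quasi_successful T Q"
    using coupling by blast
  note open_lim = semigroup_meas_open_tendsto[OF markov invariant Q]
  have \<mu>: "\<mu> \<in> space (prob_algebra borel)"
    using invariant by (simp add: invariant_prob_def)
  have in_T: "\<forall>\<^sub>F t in time_at_top T. t \<in> T"
    by (simp add: eventually_inf_principal)
  show "\<nu> = \<mu>" if inv: "invariant_prob T P \<nu>" for \<nu>
  proof (rule prob_measures_eqI_open)
    show \<nu>: "\<nu> \<in> space (prob_algebra borel)"
      using inv by (simp add: invariant_prob_def)
    show "measure \<nu> A = measure \<mu> A" if "open A" for A
    proof (rule tendsto_unique[OF time_at_top_neq_bot[OF time]])
      show "((\<lambda>t. measure \<nu> A) \<longlongrightarrow> measure \<mu> A) (time_at_top T)"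
        using open_lim[OF \<nu> that]
        by (rule Lim_transform_eventually[OF _ eventually_mono[OF in_T]])
          (use inv in \<open>simp add: invariant_prob_def\<close>)
    qed (rule tendsto_const)
  qed (rule \<mu>)
  show "weak_limit (\<lambda>t. semigroup_meas P t \<nu>) \<mu> (time_at_top T)"
    if \<nu>: "\<nu> \<in> space (prob_algebra borel)" for \<nu>
  proof (rule weak_limit_of_open_sets)
    show "\<forall>\<^sub>F t in time_at_top T. semigroup_meas P t \<nu> \<in> space (prob_algebra borel)"
      using in_T
    proof eventually_elim
      case (elim t)
      then show ?case
        using markov by (intro semigroup_meas_prob_algebra \<nu>) (simp add: markov_transition_def)
    qed
  qed (use \<mu> open_lim[OF \<nu>] in auto)
qed

end
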